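(* Let $(\mathbf{X},\mathcal{X})$ and $(\mathbf{Y},\mathcal{Y})$ be standard Borel spaces, and let $P_{XY}$ be a probability measure on $(\mathbf{X}\times\mathbf{Y},\mathcal{X}\otimes\mathcal{Y})$ with marginals $P_X$ on $\mathcal{X}$ and $P_Y$ on $\mathcal{Y}$. If there exists a $\sigma$-finite measure $\lambda_Y$ on $(\mathbf{Y},\mathcal{Y})$ such that $P_{XY}\ll P_X\otimes\lambda_Y$, then $P_{XY}\ll P_X\otimes P_Y$.
   Context: $\mu\ll\nu$ denotes absolute continuity of $\mu$ with respect to $\nu$, and $\otimes$ denotes the product measure (or product $\sigma$-algebra). *)

theory Defs
  imports "HOL-Probability.Probability"
begin

text \<open>
  Only the space and the \<open>\<sigma>\<close>-algebra of \<open>M\<close> are relevant here: they are those of the Borel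
  \<open>\<sigma>\<close>-algebra of some Polish (separable, completely metrizable) topology. The equation
  also forces \<open>space M = topspace T\<close>, the largest member of either side.
\<close>

definition standard_borel :: "'a measure \<Rightarrow> bool" where
  "standard_borel M \<longleftrightarrow>
     (\<exists>T. completely_metrizable_space T \<and> separable_space T \<and>
          sets M = sigma_sets (topspace T) {U. openin T U})"

end

theory Submission
  imports Defs
begin

text \<open>
  Write \<open>P\<^sub>X\<close>, \<open>P\<^sub>Y\<close> for the marginals and suppose that \<open>A\<close> is null for \<open>P\<^sub>X \<otimes> P\<^sub>Y\<close>. Whether a set is
  null for a product measure can be read off its horizontal sections (lemma
  \<open>null_sets_pair_iff_sections\<close>), so the set \<open>B\<close> of those \<open>y\<close> whose section of \<open>A\<close> has positive
  \<open>P\<^sub>X\<close>-measure is \<open>P\<^sub>Y\<close>-null. Split \<open>A\<close> along \<open>B\<close>. The part of \<open>A\<close> over \<open>B\<close> is \<open>P\<close>-null because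
  \<open>P\<^sub>Y\<close> is the marginal of \<open>P\<close>. In the part off \<open>B\<close> every section is \<open>P\<^sub>X\<close>-null, not just almost every
  section; hence this part is null for \<open>P\<^sub>X \<otimes> \<lambda>\<close> with any \<open>\<sigma>\<close>-finite \<open>\<lambda>\<close> whatsoever,
  and the hypothesis on \<open>P\<close> makes it \<open>P\<close>-null.
\<close>

text \<open>
  By Tonelli the product measure of \<open>A\<close> is the integral of the measures of its sections, and a
  nonnegative integral vanishes only if the integrand vanishes almost everywhere. The right-hand side
  depends on \<open>M2\<close> through its null sets alone, which is what lets one set \<open>A\<close> be tested against
  different second factors.
\<close>

lemma (in pair_sigma_finite) null_sets_pair_iff_sections:
  assumes A: "A \<in> sets (M1 \<Otimes>\<^sub>M M2)"
  shows "A \<in> null_sets (M1 \<Otimes>\<^sub>M M2) \<longleftrightarrow> (AE y in M2. emeasure M1 ((\<lambda>x. (x, y)) -` A) = 0)"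
proof -
  have "A \<in> null_sets (M1 \<Otimes>\<^sub>M M2) \<longleftrightarrow> (\<integral>\<^sup>+ y. emeasure M1 ((\<lambda>x. (x, y)) -` A) \<partial>M2) = 0"
    using A by (simp add: null_sets_def emeasure_pair_measure_alt2)
  also have "\<dots> \<longleftrightarrow> (AE y in M2. emeasure M1 ((\<lambda>x. (x, y)) -` A) = 0)"
    by (intro nn_integral_0_iff_AE measurable_emeasure_Pair2 A)
  finally show ?thesis .
qed

lemma absolutely_continuous_product_of_marginals:
  fixes MX :: "'a measure" and MY :: "'b measure" and P :: "('a \<times> 'b) measure"
  assumes P: "prob_space P" and sP: "sets P = sets (MX \<Otimes>\<^sub>M MY)"
    and L: "sigma_finite_measure L" and sL: "sets L = sets MY"
    and ac: "absolutely_continuous (distr P MX fst \<Otimes>\<^sub>M L) P"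
  shows "absolutely_continuous (distr P MX fst \<Otimes>\<^sub>M distr P MY snd) P"
  unfolding absolutely_continuous_def
proof
  let ?PX = "distr P MX fst" and ?PY = "distr P MY snd"
  have fst_meas: "fst \<in> measurable P MX" and snd_meas: "snd \<in> measurable P MY"
    by (simp_all add: measurable_cong_sets[OF sP refl])
  interpret PX: prob_space ?PX by (rule prob_space.prob_space_distr[OF P fst_meas])
  interpret PY: prob_space ?PY by (rule prob_space.prob_space_distr[OF P snd_meas])
  interpret XY: pair_sigma_finite ?PX ?PY ..
  interpret L: sigma_finite_measure L by (rule L)
  interpret XL: pair_sigma_finite ?PX L ..
  have sXY: "sets (?PX \<Otimes>\<^sub>M ?PY) = sets P"
    unfolding sP by (intro sets_pair_measure_cong) simp_all
  have sXL: "sets (?PX \<Otimes>\<^sub>M L) = sets P"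
    unfolding sP by (intro sets_pair_measure_cong) (simp_all add: sL)

  fix A assume A_null: "A \<in> null_sets (?PX \<Otimes>\<^sub>M ?PY)"
  then have A: "A \<in> sets (?PX \<Otimes>\<^sub>M ?PY)" by auto
  define s where "s = (\<lambda>y. emeasure ?PX ((\<lambda>x. (x, y)) -` A))"
  have s_meas: "s \<in> borel_measurable MY"
    using XY.measurable_emeasure_Pair2[OF A] by (simp add: s_def)
  define B where "B = {y \<in> space MY. s y \<noteq> 0}"
  have B: "B \<in> sets MY"
    unfolding B_def using s_meas by measurable

  have "AE y in ?PY. s y = 0"
    using A_null XY.null_sets_pair_iff_sections[OF A] by (simp add: s_def)
  then have "emeasure ?PY B = 0"
    using s_meas unfolding B_def by (subst (asm) AE_iff_measurable[OF _ refl]) simp_all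
  then have B_null: "snd -` B \<inter> space P \<in> null_sets P"
    using B snd_meas by (auto simp: null_sets_def emeasure_distr intro: measurable_sets)

  \<comment> \<open>Off \<open>B\<close> all sections are null, so the choice of the second factor no longer matters.\<close>
  have off_B: "A - snd -` B \<inter> space P \<in> sets (?PX \<Otimes>\<^sub>M L)"
    unfolding sXL using A[unfolded sXY] null_setsD2[OF B_null] by (rule sets.Diff)
  have "emeasure ?PX ((\<lambda>x. (x, y)) -` (A - snd -` B \<inter> space P)) = 0" for y
  proof (cases "y \<in> B")
    case True
    then have "(\<lambda>x. (x, y)) -` (A - snd -` B \<inter> space P) = {}"
      using sets.sets_into_space[OF A] sets_eq_imp_space_eq[OF sXY] by auto
    then show ?thesis by simp
  next
    case y: False
    then have "(\<lambda>x. (x, y)) -` (A - snd -` B \<inter> space P) = (\<lambda>x. (x, y)) -` A"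
      by auto
    moreover have "s y = 0"
    proof (cases "y \<in> space MY")
      case True
      then show ?thesis using y by (simp add: B_def)
    next
      case False
      then have "(\<lambda>x. (x, y)) -` A = {}"
        using sets.sets_into_space[OF A] by (auto simp: space_pair_measure)
      then show ?thesis by (simp add: s_def)
    qed
    ultimately show ?thesis by (simp add: s_def)
  qed
  then have "A - snd -` B \<inter> space P \<in> null_sets (?PX \<Otimes>\<^sub>M L)"
    using XL.null_sets_pair_iff_sections[OF off_B] by simp
  then have "A - snd -` B \<inter> space P \<in> null_sets P"
    using ac by (auto simp: absolutely_continuous_def)
  then have "(A - snd -` B \<inter> space P) \<union> (snd -` B \<inter> space P) \<in> null_sets P"
    using B_null by (rule null_sets.Un)
  then show "A \<in> null_sets P"
    by (rule null_sets_subset) (use A sXY in auto)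
qed

theorem proposition4p1:
  fixes MX :: "'a measure" and MY :: "'b measure" and P :: "('a \<times> 'b) measure"
  assumes "standard_borel MX" and "standard_borel MY"
    and "prob_space P" and "sets P = sets (MX \<Otimes>\<^sub>M MY)"
    and "\<exists>L. sigma_finite_measure L \<and> sets L = sets MY \<and>
             absolutely_continuous (distr P MX fst \<Otimes>\<^sub>M L) P"
  shows "absolutely_continuous (distr P MX fst \<Otimes>\<^sub>M distr P MY snd) P"
  using assms absolutely_continuous_product_of_marginals by blast

end
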